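(* Let $T \colon E \longrightarrow F$ be a positive operator between Banach lattices. (a) If $T$ fails to be $M$-weakly compact, then the set of norm bounded disjoint sequences $(x_j)_{j=1}^\infty$ in $E$ such that $(T(x_j))_{j=1}^\infty$ does not converge to $0$ in norm in $F$ is almost positive pointwise latticeable in $\ell_\infty(E)$. (b) If $T$ fails to be weak $M$ weakly compact, then the set of disjoint norm bounded sequences $(x_j)_{j=1}^\infty$ in $E$ such that $(T(x_j))_{j=1}^\infty$ does not converge weakly to $0$ in $F$ is almost positive pointwise latticeable in $\ell_\infty(E)$.
   Context: Banach lattices are real; operators are bounded and linear. An operator $T \colon E \to F$ from a Banach lattice $E$ to a Banach space $F$ is $M$-weakly compact if $T$ maps norm bounded disjoint sequences in $E$ to norm null sequences in $F$; it is weak $M$ weakly compact if $T$ maps disjoint norm bounded sequences in $E$ to weakly null sequences in $F$. A sequence $(x_j)_{j=1}^\infty$ in $E$ is disjoint if $|x_j| \wedge |x_k| = 0$ for $j \neq k$. $\ell_\infty(E)$ is the Banach lattice of bounded $E$-valued sequences with the supremum norm and the pointwise ordering; $X^+$ denotes the positive cone of a Banach lattice $X$. A Banach sequence lattice is a linear subspace $X$ of $E^{\mathbb{N}}$, $E$ a Banach lattice, endowed with a complete norm that makes $X$ a Banach lattice with the pointwise ordering. A subset $B$ of a Banach sequence lattice $X$ with $B \cap X^+ \neq \emptyset$ is almost positive pointwise latticeable (in $X$) if for each positive sequence $\mathbf{x} \in B$ there exists a closed infinite dimensional sublattice of $X$ contained in $B \cup \{0\}$ and containing a subsequence of $\mathbf{x}$.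 *)

theory Defs
  imports "HOL-Analysis.Analysis" "HOL-Library.Lattice_Algebras"
begin

section \<open>Banach lattices\<close>

class banach_lattice = banach + ordered_real_vector + lattice_ab_group_add_abs +
  assumes norm_le_of_abs_le: "\<bar>x\<bar> \<le> \<bar>y\<bar> \<Longrightarrow> norm x \<le> norm y"

instance real :: banach_lattice
  by standard auto

lemma norm_abs_lattice: "norm \<bar>x\<bar> = norm x" for x :: "'e::banach_lattice"
  by (rule antisym; rule norm_le_of_abs_le; simp)

lemma norm_sup_le: "norm (sup x y) \<le> norm x + norm y" for x y :: "'e::banach_lattice"
proof -
  have le: "sup x y \<le> \<bar>x\<bar> + \<bar>y\<bar>"
    by (rule sup_least)
      (use add_mono[OF abs_ge_self[of x] abs_ge_zero[of y]]
           add_mono[OF abs_ge_zero[of x] abs_ge_self[of y]] in simp_all)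
  have "- sup x y \<le> - x" by simp
  also have "- x \<le> \<bar>x\<bar> + \<bar>y\<bar>"
    by (rule add_increasing2) (auto intro: abs_ge_minus_self)
  finally have "\<bar>sup x y\<bar> \<le> \<bar>x\<bar> + \<bar>y\<bar>"
    using le by (intro abs_leI)
  then have "\<bar>sup x y\<bar> \<le> \<bar>\<bar>x\<bar> + \<bar>y\<bar>\<bar>" by simp
  then have "norm (sup x y) \<le> norm (\<bar>x\<bar> + \<bar>y\<bar>)"
    by (rule norm_le_of_abs_le)
  also have "\<dots> \<le> norm x + norm y"
    using norm_triangle_ineq[of "\<bar>x\<bar>" "\<bar>y\<bar>"] by (simp add: norm_abs_lattice)
  finally show ?thesis .
qed

lemma inf_eq_uminus_sup: "inf x y = - sup (- x) (- y)" for x y :: "'e::banach_lattice"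
  by simp

lemma bounded_uminus_range:
  "bounded (range f) \<Longrightarrow> bounded (range (\<lambda>n. - f n))" for f :: "'a \<Rightarrow> 'e::real_normed_vector"
  by (auto simp: bounded_iff)

section \<open>The Banach lattice of bounded sequences\<close>

text \<open>
  Since \<^typ>\<open>nat\<close> is discrete, \<open>nat \<Rightarrow>\<^sub>C 'e\<close> is the space of all bounded
  sequences in \<open>'e\<close>, with the supremum norm. The library proves completeness of
  \<open>'a \<Rightarrow>\<^sub>C 'b\<close> only for \<open>'a::metric_space\<close>; the metric on \<^typ>\<open>nat\<close> below
  serves to make that instance available and does not enter the norm.
\<close>

instantiation nat :: metric_space
begin

definition dist_nat :: "nat \<Rightarrow> nat \<Rightarrow> real"
  where "dist_nat m n = \<bar>real m - real n\<bar>"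

definition uniformity_nat :: "(nat \<times> nat) filter"
  where "uniformity_nat = (INF e\<in>{0 <..}. principal {(m, n). dist m n < e})"

instance
proof
  fix U :: "nat set"
  have "\<forall>\<^sub>F (m', n) in uniformity. m' = m \<longrightarrow> n \<in> U" if "m \<in> U" for m
  proof -
    have "m = n" if "\<bar>real m - real n\<bar> < 1" for n using that by linarith
    with that show ?thesis
      unfolding uniformity_nat_def
      by (intro eventually_INF1[of 1]) (auto simp: eventually_principal dist_nat_def)
  qed
  then show "open U \<longleftrightarrow> (\<forall>m\<in>U. \<forall>\<^sub>F (m', n) in uniformity. m' = m \<longrightarrow> n \<in> U)"
    by (simp add: open_discrete)
qed (auto simp: uniformity_nat_def dist_nat_def)

end

lemma bcontfun_discrete_iff:
  "f \<in> bcontfun \<longleftrightarrow> bounded (range f)" for f :: "'a::discrete_topology \<Rightarrow> 'b::metric_space"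
  by (auto simp: bcontfun_def continuous_on_open_vimage open_discrete)

lemma bounded_sup_comp:
  fixes f g :: "'a \<Rightarrow> 'e::banach_lattice"
  assumes "bounded (range f)" "bounded (range g)"
  shows "bounded (range (\<lambda>n. sup (f n) (g n)))"
proof -
  from assms obtain A B where "\<And>n. norm (f n) \<le> A" "\<And>n. norm (g n) \<le> B"
    by (auto simp: bounded_iff)
  then have "norm (sup (f n) (g n)) \<le> A + B" for n
    by (meson norm_sup_le add_mono order_trans)
  then show ?thesis by (auto simp: bounded_iff)
qed

instance bcontfun :: (metric_space, banach) banach ..

instantiation bcontfun :: ("{discrete_topology, metric_space}", banach_lattice) banach_lattice
begin

definition less_eq_bcontfun :: "('a \<Rightarrow>\<^sub>C 'b) \<Rightarrow> ('a \<Rightarrow>\<^sub>C 'b) \<Rightarrow> bool"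
  where "f \<le> g \<longleftrightarrow> (\<forall>n. apply_bcontfun f n \<le> apply_bcontfun g n)"

definition less_bcontfun :: "('a \<Rightarrow>\<^sub>C 'b) \<Rightarrow> ('a \<Rightarrow>\<^sub>C 'b) \<Rightarrow> bool"
  where "f < g \<longleftrightarrow> f \<le> g \<and> \<not> g \<le> f" for f g :: "'a \<Rightarrow>\<^sub>C 'b"

definition sup_bcontfun :: "('a \<Rightarrow>\<^sub>C 'b) \<Rightarrow> ('a \<Rightarrow>\<^sub>C 'b) \<Rightarrow> 'a \<Rightarrow>\<^sub>C 'b"
  where "sup f g = Bcontfun (\<lambda>n. sup (apply_bcontfun f n) (apply_bcontfun g n))"

definition inf_bcontfun :: "('a \<Rightarrow>\<^sub>C 'b) \<Rightarrow> ('a \<Rightarrow>\<^sub>C 'b) \<Rightarrow> 'a \<Rightarrow>\<^sub>C 'b"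
  where "inf f g = Bcontfun (\<lambda>n. inf (apply_bcontfun f n) (apply_bcontfun g n))"

definition abs_bcontfun :: "('a \<Rightarrow>\<^sub>C 'b) \<Rightarrow> 'a \<Rightarrow>\<^sub>C 'b"
  where "\<bar>f\<bar> = Bcontfun (\<lambda>n. \<bar>apply_bcontfun f n\<bar>)"

lemma apply_bcontfun_sup [simp]:
  "apply_bcontfun (sup f g) n = sup (apply_bcontfun f n) (apply_bcontfun g n)"
  for f g :: "'a \<Rightarrow>\<^sub>C 'b"
  unfolding sup_bcontfun_def
  by (subst Bcontfun_inverse) (auto simp: bcontfun_discrete_iff intro: bounded_sup_comp)

lemma apply_bcontfun_inf [simp]:
  "apply_bcontfun (inf f g) n = inf (apply_bcontfun f n) (apply_bcontfun g n)"
  for f g :: "'a \<Rightarrow>\<^sub>C 'b"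
proof -
  have "(\<lambda>n. inf (apply_bcontfun f n) (apply_bcontfun g n)) \<in> bcontfun"
    unfolding inf_eq_uminus_sup
    by (intro uminus_cont) (simp add: bcontfun_discrete_iff bounded_sup_comp bounded_uminus_range
        del: neg_sup_eq_inf neg_inf_eq_sup)
  then show ?thesis
    unfolding inf_bcontfun_def by (subst Bcontfun_inverse) auto
qed

lemma apply_bcontfun_abs [simp]:
  "apply_bcontfun \<bar>f\<bar> n = \<bar>apply_bcontfun f n\<bar>" for f :: "'a \<Rightarrow>\<^sub>C 'b"
proof -
  have "bounded (range (\<lambda>n. \<bar>apply_bcontfun f n\<bar>))"
    using bounded_apply_bcontfun[of f] by (auto simp: bounded_iff norm_abs_lattice)
  then show ?thesis
    unfolding abs_bcontfun_def by (subst Bcontfun_inverse) (auto simp: bcontfun_discrete_iff)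
qed

instance
proof
  fix x y z :: "'a \<Rightarrow>\<^sub>C 'b" and a b :: real
  show "(x < y) = (x \<le> y \<and> \<not> y \<le> x)" by (rule less_bcontfun_def)
  show "x \<le> x" by (simp add: less_eq_bcontfun_def)
  show "x \<le> z" if "x \<le> y" "y \<le> z"
    using that by (auto simp: less_eq_bcontfun_def intro: order_trans)
  show "x = y" if "x \<le> y" "y \<le> x"
    using that by (auto simp: less_eq_bcontfun_def intro!: bcontfun_eqI antisym)
  show "inf x y \<le> x" "inf x y \<le> y" "x \<le> sup x y" "y \<le> sup x y"
    by (auto simp: less_eq_bcontfun_def)
  show "x \<le> inf y z" if "x \<le> y" "x \<le> z"
    using that by (auto simp: less_eq_bcontfun_def)
  show "sup y z \<le> x" if "y \<le> x" "z \<le> x"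
    using that by (auto simp: less_eq_bcontfun_def)
  show "z + x \<le> z + y" if "x \<le> y"
    using that by (auto simp: less_eq_bcontfun_def)
  show "a *\<^sub>R x \<le> a *\<^sub>R y" if "x \<le> y" "0 \<le> a"
    using that by (auto simp: less_eq_bcontfun_def intro: scaleR_left_mono)
  show "a *\<^sub>R x \<le> b *\<^sub>R x" if "a \<le> b" "0 \<le> x"
    using that by (auto simp: less_eq_bcontfun_def intro: scaleR_right_mono)
  show "\<bar>x\<bar> = sup x (- x)"
    by (rule bcontfun_eqI) (simp add: abs_lattice)
  show "norm x \<le> norm y" if "\<bar>x\<bar> \<le> \<bar>y\<bar>"
  proof (rule norm_bound)
    fix n
    have "norm (apply_bcontfun x n) \<le> norm (apply_bcontfun y n)"
      using that by (intro norm_le_of_abs_le) (simp add: less_eq_bcontfun_def)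
    also have "\<dots> \<le> norm y" by (rule norm_bounded)
    finally show "norm (apply_bcontfun x n) \<le> norm y" .
  qed
qed

end

section \<open>Almost positive pointwise latticeability\<close>

text \<open>
  Vector sublattices of a Banach lattice: the lattice operations are those of the ambient lattice.
\<close>

definition sublattice :: "'x::banach_lattice set \<Rightarrow> bool"
  where "sublattice S \<longleftrightarrow> subspace S \<and> (\<forall>x\<in>S. \<forall>y\<in>S. sup x y \<in> S \<and> inf x y \<in> S)"

text \<open>The constant \<^const>\<open>dim\<close> is 0 on infinite dimensional subspaces, hence the explicit form.\<close>

definition infinite_dimensional :: "'x::real_vector set \<Rightarrow> bool"
  where "infinite_dimensional S \<longleftrightarrow> \<not> (\<exists>b. finite b \<and> S \<subseteq> span b)"

text \<open>
  A Banach sequence lattice is given as a Banach lattice \<open>'x\<close> together with the inclusion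
  \<open>coord\<close> of \<open>'x\<close> into the space of all sequences in \<open>'e\<close>: \<open>coord\<close> is linear, and the order of
  \<open>'x\<close> is the pointwise order of its image.
  Injectivity follows (lemma \<open>coord_inject\<close>); the norm and the lattice operations are those of \<open>'x\<close>.
\<close>

locale banach_sequence_lattice =
  fixes coord :: "'x::banach_lattice \<Rightarrow> nat \<Rightarrow> 'e::banach_lattice"
  assumes coord_add: "coord (x + y) n = coord x n + coord y n"
    and coord_scaleR: "coord (c *\<^sub>R x) n = c *\<^sub>R coord x n"
    and le_iff_coord: "x \<le> y \<longleftrightarrow> (\<forall>n. coord x n \<le> coord y n)"
begin

lemma coord_inject: "coord x = coord y \<longleftrightarrow> x = y"
  by (metis antisym le_iff_coord order_refl)

definition subsequence_of :: "'x \<Rightarrow> 'x \<Rightarrow> bool"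
  where "subsequence_of y x \<longleftrightarrow> (\<exists>r. strict_mono r \<and> coord y = coord x \<circ> r)"

definition almost_positive_pointwise_latticeable :: "'x set \<Rightarrow> bool"
  where "almost_positive_pointwise_latticeable B \<longleftrightarrow>
    B \<inter> {x. 0 \<le> x} \<noteq> {} \<and>
    (\<forall>x\<in>B. 0 \<le> x \<longrightarrow>
      (\<exists>S. closed S \<and> infinite_dimensional S \<and> sublattice S \<and> S \<subseteq> B \<union> {0} \<and>
        (\<exists>y\<in>S. subsequence_of y x)))"

end

interpretation linf: banach_sequence_lattice
  "apply_bcontfun :: (nat \<Rightarrow>\<^sub>C 'e::banach_lattice) \<Rightarrow> nat \<Rightarrow> 'e"
  by standard (simp_all add: less_eq_bcontfun_def)

section \<open>Classes of operators\<close>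

definition disjoint_seq :: "(nat \<Rightarrow> 'e::banach_lattice) \<Rightarrow> bool"
  where "disjoint_seq x \<longleftrightarrow> (\<forall>j k. j \<noteq> k \<longrightarrow> inf \<bar>x j\<bar> \<bar>x k\<bar> = 0)"

definition weakly_null :: "(nat \<Rightarrow> 'f::real_normed_vector) \<Rightarrow> bool"
  where "weakly_null y \<longleftrightarrow>
    (\<forall>\<phi> :: 'f \<Rightarrow>\<^sub>L real. (\<lambda>n. blinfun_apply \<phi> (y n)) \<longlonglongrightarrow> 0)"

definition positive_operator :: "('e::banach_lattice \<Rightarrow>\<^sub>L 'f::banach_lattice) \<Rightarrow> bool"
  where "positive_operator T \<longleftrightarrow> (\<forall>x\<ge>0. 0 \<le> blinfun_apply T x)"

definition M_weakly_compact :: "('e::banach_lattice \<Rightarrow>\<^sub>L 'f::banach) \<Rightarrow> bool"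
  where "M_weakly_compact T \<longleftrightarrow>
    (\<forall>x. bounded (range x) \<longrightarrow> disjoint_seq x \<longrightarrow> (\<lambda>n. blinfun_apply T (x n)) \<longlonglongrightarrow> 0)"

definition weak_M_weakly_compact :: "('e::banach_lattice \<Rightarrow>\<^sub>L 'f::banach) \<Rightarrow> bool"
  where "weak_M_weakly_compact T \<longleftrightarrow>
    (\<forall>x. bounded (range x) \<longrightarrow> disjoint_seq x \<longrightarrow> weakly_null (\<lambda>n. blinfun_apply T (x n)))"

end

theory Submission
  imports Defs
begin

text \<open>
  Let \<open>x\<close> be a positive, disjoint, bounded sequence that an operator does not send to a (weakly)
  null sequence. Some subsequence \<open>y\<close> has images that stay away from \<open>0\<close>, in norm or under some
  fixed functional. Split the index set into infinitely many infinite blocks and multiply \<open>y\<close>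
  blockwise by the entries of a bounded real sequence \<open>c\<close>. As \<open>y\<close> is positive and bounded away
  from \<open>0\<close> in norm, \<open>c \<mapsto> c \<cdot> y\<close> is a lattice embedding of \<open>\<ell>\<^sub>\<infinity>\<close> into \<open>\<ell>\<^sub>\<infinity>(E)\<close> that is bounded
  below, so its range is a closed infinite dimensional sublattice; it contains \<open>y\<close>, the image of
  the constant sequence \<open>1\<close>. If \<open>c \<noteq> 0\<close>, some entry \<open>c\<^sub>k\<close> is nonzero, and on the infinite block
  \<open>k\<close> the images of \<open>c \<cdot> y\<close> are \<open>c\<^sub>k\<close> times those of \<open>y\<close>: they do not tend to \<open>0\<close>.

  Both parts of the theorem are instances of this argument, with the size of the image measured by
  the absolutely homogeneous function \<open>norm (T u)\<close>, respectively \<open>\<bar>\<phi> (T u)\<bar>\<close> for a functional \<open>\<phi>\<close>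
  (lemma \<open>latticeable_of_homogeneous\<close>). That positive sequences of the required kind exist follows
  by splitting a sequence into its positive and negative parts
  (lemma \<open>exists_nonneg_disjoint_not_null\<close>).
\<close>

section \<open>Disjointness and multiples in Banach lattices\<close>

lemma abs_scaleR_le: "\<bar>c *\<^sub>R u\<bar> \<le> \<bar>c\<bar> *\<^sub>R \<bar>u\<bar>" for u :: "'e::banach_lattice"
proof -
  have nonneg: "\<bar>a *\<^sub>R u\<bar> \<le> a *\<^sub>R \<bar>u\<bar>" if "0 \<le> a" for a
  proof (rule abs_leI)
    show "a *\<^sub>R u \<le> a *\<^sub>R \<bar>u\<bar>"
      using that by (intro scaleR_left_mono abs_ge_self)
    have "a *\<^sub>R (- u) \<le> a *\<^sub>R \<bar>u\<bar>"
      using that by (intro scaleR_left_mono) (auto intro: abs_ge_minus_self)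
    then show "- (a *\<^sub>R u) \<le> a *\<^sub>R \<bar>u\<bar>" by simp
  qed
  show ?thesis
  proof (cases "0 \<le> c")
    case True
    then show ?thesis using nonneg[of c] by simp
  next
    case False
    then show ?thesis using nonneg[of "- c"] by simp
  qed
qed

lemma scaleR_sup_nonneg:
  fixes u :: "'e::banach_lattice"
  assumes "0 \<le> u"
  shows "sup a b *\<^sub>R u = sup (a *\<^sub>R u) (b *\<^sub>R u)"
proof (cases "a \<le> b")
  case True
  then show ?thesis using scaleR_right_mono[OF True assms] by (simp add: sup_absorb2)
next
  case False
  then have "b \<le> a" by simp
  then show ?thesis using scaleR_right_mono[OF _ assms, of b a] by (simp add: sup_absorb1)
qed

lemma scaleR_inf_nonneg:
  fixes u :: "'e::banach_lattice"
  assumes "0 \<le> u"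
  shows "inf a b *\<^sub>R u = inf (a *\<^sub>R u) (b *\<^sub>R u)"
proof (cases "a \<le> b")
  case True
  then show ?thesis using scaleR_right_mono[OF True assms] by (simp add: inf_absorb1)
next
  case False
  then have "b \<le> a" by simp
  then show ?thesis using scaleR_right_mono[OF _ assms, of b a] by (simp add: inf_absorb2)
qed

lemma disjoint_dominated:
  fixes u v u' v' :: "'e::banach_lattice"
  assumes "inf \<bar>u\<bar> \<bar>v\<bar> = 0" "\<bar>u'\<bar> \<le> \<bar>u\<bar>" "\<bar>v'\<bar> \<le> \<bar>v\<bar>"
  shows "inf \<bar>u'\<bar> \<bar>v'\<bar> = 0"
  using inf_mono[OF assms(2,3)] assms(1) by (simp add: antisym)

text \<open>
  Both multiples are dominated by those with the common factor \<open>m\<close>, and multiplication by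
  \<open>m > 0\<close> commutes with infima because division by \<open>m\<close> is monotone as well.
\<close>
lemma disjoint_scaleR:
  fixes u v :: "'e::banach_lattice"
  assumes "inf \<bar>u\<bar> \<bar>v\<bar> = 0"
  shows "inf \<bar>a *\<^sub>R u\<bar> \<bar>b *\<^sub>R v\<bar> = 0"
proof -
  define m where "m = max 1 (max \<bar>a\<bar> \<bar>b\<bar>)"
  have m: "0 < m" "\<bar>a\<bar> \<le> m" "\<bar>b\<bar> \<le> m" by (auto simp: m_def)
  define w where "w = inf \<bar>a *\<^sub>R u\<bar> \<bar>b *\<^sub>R v\<bar>"
  have "w \<le> \<bar>a *\<^sub>R u\<bar>" by (simp add: w_def)
  also have "\<dots> \<le> \<bar>a\<bar> *\<^sub>R \<bar>u\<bar>" by (rule abs_scaleR_le)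
  also have "\<dots> \<le> m *\<^sub>R \<bar>u\<bar>" using m by (intro scaleR_right_mono) auto
  finally have "inverse m *\<^sub>R w \<le> inverse m *\<^sub>R (m *\<^sub>R \<bar>u\<bar>)"
    using m by (intro scaleR_left_mono) auto
  then have 1: "inverse m *\<^sub>R w \<le> \<bar>u\<bar>" using m by simp
  have "w \<le> \<bar>b *\<^sub>R v\<bar>" by (simp add: w_def)
  also have "\<dots> \<le> \<bar>b\<bar> *\<^sub>R \<bar>v\<bar>" by (rule abs_scaleR_le)
  also have "\<dots> \<le> m *\<^sub>R \<bar>v\<bar>" using m by (intro scaleR_right_mono) auto
  finally have "inverse m *\<^sub>R w \<le> inverse m *\<^sub>R (m *\<^sub>R \<bar>v\<bar>)"
    using m by (intro scaleR_left_mono) auto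
  then have "inverse m *\<^sub>R w \<le> \<bar>v\<bar>" using m by simp
  with 1 have "inverse m *\<^sub>R w \<le> 0" using assms by (metis inf_greatest)
  then have "m *\<^sub>R (inverse m *\<^sub>R w) \<le> m *\<^sub>R 0"
    using m by (intro scaleR_left_mono) auto
  then have "w \<le> 0" using m by simp
  moreover have "0 \<le> w" by (simp add: w_def)
  ultimately show ?thesis by (simp add: w_def antisym)
qed

section \<open>Blockwise multiples of a sequence\<close>

lemma infinite_dimensional_if_independent:
  assumes "independent A" "infinite A" "A \<subseteq> S"
  shows "infinite_dimensional S"
  using assms independent_span_bound unfolding infinite_dimensional_def by blast

definition unit_seq :: "nat \<Rightarrow> nat \<Rightarrow>\<^sub>C real"
  where "unit_seq k = Bcontfun (\<lambda>j. if j = k then 1 else 0)"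

lemma apply_unit_seq [simp]: "apply_bcontfun (unit_seq k) j = (if j = k then 1 else 0)"
  unfolding unit_seq_def
  by (subst Bcontfun_inverse) (auto simp: bcontfun_discrete_iff bounded_iff intro!: exI[of _ 1])

lemma inj_unit_seq: "inj unit_seq"
proof (rule injI)
  fix k l
  assume "unit_seq k = unit_seq l"
  then have "apply_bcontfun (unit_seq k) k = apply_bcontfun (unit_seq l) k" by simp
  then show "k = l" by (simp split: if_splits)
qed

lemma apply_bcontfun_sum:
  "apply_bcontfun (sum f A) j = (\<Sum>v\<in>A. apply_bcontfun (f v) j)"
  by (induction A rule: infinite_finite_induct) auto

lemma independent_unit_seq: "independent (range unit_seq)"
proof
  assume "dependent (range unit_seq)"
  then obtain t u where t: "finite t" "t \<subseteq> range unit_seq" "(\<Sum>v\<in>t. u v *\<^sub>R v) = 0"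
    and "\<exists>v\<in>t. u v \<noteq> 0"
    by (auto simp: dependent_explicit)
  then obtain k where k: "unit_seq k \<in> t" "u (unit_seq k) \<noteq> 0" by blast
  have "0 = apply_bcontfun (\<Sum>v\<in>t. u v *\<^sub>R v) k" using t by simp
  also have "\<dots> = (\<Sum>v\<in>t. u v * apply_bcontfun v k)" by (simp add: apply_bcontfun_sum)
  also have "\<dots> = (\<Sum>v\<in>t. if v = unit_seq k then u v else 0)"
  proof (rule sum.cong)
    fix v
    assume "v \<in> t"
    with t obtain l where "v = unit_seq l" by blast
    then show "u v * apply_bcontfun v k = (if v = unit_seq k then u v else 0)"
      using inj_unit_seq by (auto simp: inj_eq)
  qed simp
  also have "\<dots> = u (unit_seq k)" using t k by simp
  finally show False using k by simp
qed

text \<open>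
  The blocks are the fibres of the first component of the pairing bijection, so that there are
  infinitely many of them and each is infinite.
\<close>
definition block :: "nat \<Rightarrow> nat"
  where "block j = fst (prod_decode j)"

lemma infinite_block: "infinite {j. block j = k}"
proof -
  have "range (\<lambda>m. prod_encode (k, m)) \<subseteq> {j. block j = k}" by (auto simp: block_def)
  moreover have "infinite (range (\<lambda>m. prod_encode (k, m)))"
    by (rule range_inj_infinite) (auto intro!: injI)
  ultimately show ?thesis by (rule infinite_super)
qed

definition block_multiple ::
    "(nat \<Rightarrow>\<^sub>C 'e::banach_lattice) \<Rightarrow> (nat \<Rightarrow>\<^sub>C real) \<Rightarrow> nat \<Rightarrow>\<^sub>C 'e"
  where "block_multiple y c =
    Bcontfun (\<lambda>j. apply_bcontfun c (block j) *\<^sub>R apply_bcontfun y j)"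

lemma norm_block_multiple_apply_le:
  "norm (apply_bcontfun c (block j) *\<^sub>R apply_bcontfun y j) \<le> norm c * norm y"
  using norm_bounded[of c "block j"] norm_bounded[of y j] by (simp add: mult_mono)

lemma apply_block_multiple [simp]:
  "apply_bcontfun (block_multiple y c) j = apply_bcontfun c (block j) *\<^sub>R apply_bcontfun y j"
  unfolding block_multiple_def
  by (subst Bcontfun_inverse)
    (use norm_block_multiple_apply_le in \<open>auto simp: bcontfun_discrete_iff bounded_iff\<close>)

lemma bounded_linear_block_multiple: "bounded_linear (block_multiple y)"
proof
  show "\<exists>K. \<forall>c. norm (block_multiple y c) \<le> norm c * K"
    using norm_block_multiple_apply_le by (intro exI[of _ "norm y"] allI norm_bound) simp
qed (auto intro!: bcontfun_eqI simp: scaleR_add_left)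

lemma block_multiple_lower_bound:
  assumes "\<And>j. \<epsilon> \<le> norm (apply_bcontfun y j)" "0 < \<epsilon>"
  shows "\<epsilon> * norm c \<le> norm (block_multiple y c)"
proof -
  have "norm c \<le> norm (block_multiple y c) / \<epsilon>"
  proof (rule norm_bound)
    fix k
    obtain j where j: "block j = k" using infinite_block[of k] not_finite_existsD by blast
    have "norm (apply_bcontfun c k) * \<epsilon> \<le> norm (apply_bcontfun c k) * norm (apply_bcontfun y j)"
      using assms by (intro mult_left_mono) auto
    also have "\<dots> = norm (apply_bcontfun (block_multiple y c) j)" using j by simp
    also have "\<dots> \<le> norm (block_multiple y c)" by (rule norm_bounded)
    finally show "norm (apply_bcontfun c k) \<le> norm (block_multiple y c) / \<epsilon>"
      using assms by (simp add: field_simps)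
  qed
  then show ?thesis using assms by (simp add: field_simps)
qed

text \<open>A linear map that is bounded below has a complete range when its domain is complete.\<close>
lemma closed_range_block_multiple:
  assumes "\<And>j. \<epsilon> \<le> norm (apply_bcontfun y j)" "0 < \<epsilon>"
  shows "closed (range (block_multiple y))"
proof -
  have "complete (range (block_multiple y))"
    using assms block_multiple_lower_bound[OF assms]
    by (intro complete_isometric_image[of \<epsilon> UNIV "block_multiple y"]
        bounded_linear_block_multiple) (auto simp: complete_UNIV)
  then show ?thesis by (rule complete_imp_closed)
qed

lemma infinite_dimensional_range_block_multiple:
  assumes "\<And>j. \<epsilon> \<le> norm (apply_bcontfun y j)" "0 < \<epsilon>"
  shows "infinite_dimensional (range (block_multiple y))"
proof -
  interpret bounded_linear "block_multiple y" by (rule bounded_linear_block_multiple)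
  have inj: "inj (block_multiple y)"
  proof (rule injI)
    fix c d
    assume "block_multiple y c = block_multiple y d"
    then have "\<epsilon> * norm (c - d) \<le> 0"
      using block_multiple_lower_bound[OF assms, of "c - d"] by (simp add: diff)
    then show "c = d" using assms(2) by (simp add: mult_le_0_iff)
  qed
  show ?thesis
  proof (rule infinite_dimensional_if_independent)
    show "independent (block_multiple y ` range unit_seq)"
      using independent_unit_seq inj linear_axioms
      by (intro linear_independent_injective_image) (auto intro: inj_on_subset)
    show "infinite (block_multiple y ` range unit_seq)"
      using inj inj_unit_seq
      by (metis finite_imageD infinite_UNIV_nat inj_on_subset subset_UNIV)
  qed auto
qed

lemma sublattice_range_block_multiple:
  assumes "0 \<le> y"
  shows "sublattice (range (block_multiple y))"
proof -
  have pos: "0 \<le> apply_bcontfun y j" for j using assms by (simp add: less_eq_bcontfun_def)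
  have "block_multiple y (sup c d) = sup (block_multiple y c) (block_multiple y d)"
    "block_multiple y (inf c d) = inf (block_multiple y c) (block_multiple y d)" for c d
    \<comment> \<open>The simplifier would turn \<open>sup\<close> and \<open>inf\<close> of reals into \<open>max\<close> and \<open>min\<close>.\<close>
    by (auto intro!: bcontfun_eqI simp: scaleR_sup_nonneg scaleR_inf_nonneg pos simp flip: sup_max inf_min)
  moreover have "subspace (range (block_multiple y))"
    using bounded_linear.linear[OF bounded_linear_block_multiple]
    by (rule linear_subspace_image) simp
  ultimately show ?thesis unfolding sublattice_def by (metis imageE rangeI)
qed

lemma disjoint_block_multiple:
  "disjoint_seq (apply_bcontfun y) \<Longrightarrow> disjoint_seq (apply_bcontfun (block_multiple y c))"
  by (simp add: disjoint_seq_def disjoint_scaleR)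

lemma block_multiple_not_null:
  fixes G :: "'e::banach_lattice \<Rightarrow> real"
  assumes homogeneous: "\<And>a u. G (a *\<^sub>R u) = \<bar>a\<bar> * G u"
    and lower: "\<And>j. \<delta> \<le> G (apply_bcontfun y j)" "0 < \<delta>"
    and "block_multiple y c \<noteq> 0"
  shows "\<not> (\<lambda>j. G (apply_bcontfun (block_multiple y c) j)) \<longlonglongrightarrow> 0"
proof
  assume lim: "(\<lambda>j. G (apply_bcontfun (block_multiple y c) j)) \<longlonglongrightarrow> 0"
  have "\<exists>k. apply_bcontfun c k \<noteq> 0"
    using assms(4) by (auto intro: bcontfun_eqI)
  then obtain k where k: "apply_bcontfun c k \<noteq> 0" by blast
  have "\<forall>\<^sub>F j in sequentially.
      G (apply_bcontfun (block_multiple y c) j) < \<bar>apply_bcontfun c k\<bar> * \<delta>"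
    using lim k lower(2) by (intro order_tendstoD(2)[of _ 0]) auto
  then obtain n where n: "\<And>j. n \<le> j \<Longrightarrow>
      G (apply_bcontfun (block_multiple y c) j) < \<bar>apply_bcontfun c k\<bar> * \<delta>"
    by (auto simp: eventually_sequentially)
  obtain j where "n \<le> j" "block j = k"
    using infinite_block[of k] by (auto simp: infinite_nat_iff_unbounded_le)
  then have "\<bar>apply_bcontfun c k\<bar> * G (apply_bcontfun y j) < \<bar>apply_bcontfun c k\<bar> * \<delta>"
    using n[of j] by (simp add: homogeneous)
  moreover have "\<bar>apply_bcontfun c k\<bar> * \<delta> \<le> \<bar>apply_bcontfun c k\<bar> * G (apply_bcontfun y j)"
    using lower(1) by (intro mult_left_mono) auto
  ultimately show False by simp
qed

section \<open>Lattices of sequences that are not null\<close>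

lemma not_null_imp_subseq_bounded_below:
  fixes a :: "nat \<Rightarrow> real"
  assumes "\<And>n. 0 \<le> a n" "\<not> a \<longlonglongrightarrow> 0"
  obtains \<delta> and r :: "nat \<Rightarrow> nat"
  where "0 < \<delta>" "strict_mono r" "\<And>n. \<delta> \<le> a (r n)"
proof -
  from assms obtain \<delta> where "0 < \<delta>" and "\<forall>N. \<exists>n\<ge>N. \<delta> \<le> a n"
    unfolding LIMSEQ_iff by (force simp: not_less)
  then have "infinite {n. \<delta> \<le> a n}" by (auto simp: infinite_nat_iff_unbounded_le)
  then show thesis using that \<open>0 < \<delta>\<close> infinite_enumerate by blast
qed

text \<open>
  The continuity bound on \<open>G\<close> serves to turn the lower bound on \<open>G\<close> along the subsequence into one
  on its norm, which makes the range of the blockwise multiples closed.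
\<close>
lemma latticeable_of_homogeneous:
  fixes x :: "nat \<Rightarrow>\<^sub>C 'e::banach_lattice" and G :: "'e \<Rightarrow> real"
  assumes homogeneous: "\<And>a u. G (a *\<^sub>R u) = \<bar>a\<bar> * G u"
    and nonneg: "\<And>u. 0 \<le> G u"
    and bound: "\<And>u. G u \<le> K * norm u"
    and x: "0 \<le> x" "disjoint_seq (apply_bcontfun x)"
    and not_null: "\<not> (\<lambda>j. G (apply_bcontfun x j)) \<longlonglongrightarrow> 0"
  shows "\<exists>S. closed S \<and> infinite_dimensional S \<and> sublattice S \<and>
    S \<subseteq> {z. disjoint_seq (apply_bcontfun z) \<and> \<not> (\<lambda>j. G (apply_bcontfun z j)) \<longlonglongrightarrow> 0} \<union> {0} \<and>
    (\<exists>y\<in>S. linf.subsequence_of y x)"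
proof -
  obtain \<delta> and r :: "nat \<Rightarrow> nat"
    where r: "0 < \<delta>" "strict_mono r" "\<And>n. \<delta> \<le> G (apply_bcontfun x (r n))"
    using not_null_imp_subseq_bounded_below[OF nonneg not_null] by blast
  define y where "y = Bcontfun (apply_bcontfun x \<circ> r)"
  have "bounded (range (apply_bcontfun x \<circ> r))"
    by (rule bounded_subset[OF bounded_apply_bcontfun[of x]]) auto
  then have y: "apply_bcontfun y = apply_bcontfun x \<circ> r"
    unfolding y_def by (subst Bcontfun_inverse) (auto simp: bcontfun_discrete_iff)
  have lower: "\<delta> \<le> G (apply_bcontfun y j)" for j using r by (simp add: y)
  \<comment> \<open>Enlarging \<open>K\<close> to a positive constant makes the quotient below meaningful.\<close>
  define K' where "K' = max 1 K"
  have "0 < K'" by (simp add: K'_def)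
  have "\<delta> \<le> K' * norm (apply_bcontfun y j)" for j
  proof -
    have "K * norm (apply_bcontfun y j) \<le> K' * norm (apply_bcontfun y j)"
      by (intro mult_right_mono) (auto simp: K'_def)
    then show ?thesis using lower[of j] bound[of "apply_bcontfun y j"] by linarith
  qed
  then have away: "\<delta> / K' \<le> norm (apply_bcontfun y j)" for j
    using \<open>0 < K'\<close> by (simp add: field_simps)
  have pos: "0 < \<delta> / K'" using \<open>0 < K'\<close> r(1) by simp
  have "0 \<le> y" using x(1) by (simp add: less_eq_bcontfun_def y)
  have disj: "disjoint_seq (apply_bcontfun y)"
    using x(2) strict_mono_eq[OF r(2)] by (simp add: disjoint_seq_def y)
  let ?S = "range (block_multiple y)"
  have "?S \<subseteq> {z. disjoint_seq (apply_bcontfun z) \<and>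
      \<not> (\<lambda>j. G (apply_bcontfun z j)) \<longlonglongrightarrow> 0} \<union> {0}"
    using block_multiple_not_null[of G, OF homogeneous lower r(1)] disjoint_block_multiple[OF disj]
    by blast
  moreover have "y \<in> ?S"
  proof
    show "y = block_multiple y (const_bcontfun 1)" by (rule bcontfun_eqI) simp
  qed simp
  moreover have "linf.subsequence_of y x"
    using r(2) y by (auto simp: linf.subsequence_of_def)
  ultimately show ?thesis
    using closed_range_block_multiple[OF away pos] sublattice_range_block_multiple[OF \<open>0 \<le> y\<close>]
      infinite_dimensional_range_block_multiple[OF away pos]
    by blast
qed

text \<open>
  If \<open>P\<close> holds for the positive and for the negative part of \<open>x\<close>, then it holds for \<open>x\<close>; hence a
  witness against \<open>P\<close> can be chosen positive.
\<close>
lemma exists_nonneg_disjoint_not_null: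
  fixes x :: "nat \<Rightarrow> 'e::banach_lattice" and P :: "(nat \<Rightarrow> 'e) \<Rightarrow> bool"
  assumes diff: "\<And>u v. P u \<Longrightarrow> P v \<Longrightarrow> P (\<lambda>j. u j - v j)"
    and x: "bounded (range x)" "disjoint_seq x" "\<not> P x"
  shows "\<exists>z :: nat \<Rightarrow>\<^sub>C 'e. 0 \<le> z \<and> disjoint_seq (apply_bcontfun z) \<and> \<not> P (apply_bcontfun z)"
proof -
  have "x = (\<lambda>j. sup (x j) 0 - sup (- x j) 0)"
  proof
    fix j
    have "x j = sup (x j) 0 + inf (x j) 0" using prts[of "x j"] by (simp add: pprt_def nprt_def)
    also have "inf (x j) 0 = - sup (- x j) 0" by simp
    finally show "x j = sup (x j) 0 - sup (- x j) 0" by simp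
  qed
  then have "\<not> P (\<lambda>j. sup (x j) 0) \<or> \<not> P (\<lambda>j. sup (- x j) 0)" using diff x(3) by metis
  then obtain w where w: "w = x \<or> w = (\<lambda>j. - x j)" "\<not> P (\<lambda>j. sup (w j) 0)" by blast
  have le: "\<bar>sup (w j) 0\<bar> \<le> \<bar>x j\<bar>" for j
  proof -
    have "w j \<le> \<bar>x j\<bar>" using w(1) by (auto intro: abs_ge_self abs_ge_minus_self)
    then show ?thesis by simp
  qed
  obtain K where "norm (x j) \<le> K" for j using x(1) by (auto simp: bounded_iff)
  then have "norm (sup (w j) 0) \<le> K" for j
    using norm_le_of_abs_le[OF le] by (meson order_trans)
  then have "bounded (range (\<lambda>j. sup (w j) 0))" by (auto simp: bounded_iff)
  then have z: "apply_bcontfun (Bcontfun (\<lambda>j. sup (w j) 0)) = (\<lambda>j. sup (w j) 0)"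
    by (subst Bcontfun_inverse) (auto simp: bcontfun_discrete_iff)
  have "disjoint_seq (\<lambda>j. sup (w j) 0)"
    using x(2) disjoint_dominated le unfolding disjoint_seq_def by blast
  with z w(2) show ?thesis
    by (intro exI[of _ "Bcontfun (\<lambda>j. sup (w j) 0)"]) (simp add: less_eq_bcontfun_def)
qed

theorem corollary4p14:
  fixes T :: "'e::banach_lattice \<Rightarrow>\<^sub>L 'f::banach_lattice"
  assumes "positive_operator T"
  shows "(\<not> M_weakly_compact T \<longrightarrow>
      linf.almost_positive_pointwise_latticeable
        {x :: nat \<Rightarrow>\<^sub>C 'e. disjoint_seq (apply_bcontfun x) \<and>
          \<not> (\<lambda>j. blinfun_apply T (apply_bcontfun x j)) \<longlonglongrightarrow> 0})
    \<and> (\<not> weak_M_weakly_compact T \<longrightarrow>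
      linf.almost_positive_pointwise_latticeable
        {x :: nat \<Rightarrow>\<^sub>C 'e. disjoint_seq (apply_bcontfun x) \<and>
          \<not> weakly_null (\<lambda>j. blinfun_apply T (apply_bcontfun x j))})"
proof (intro conjI impI)
  let ?B = "{x :: nat \<Rightarrow>\<^sub>C 'e. disjoint_seq (apply_bcontfun x) \<and>
          \<not> (\<lambda>j. blinfun_apply T (apply_bcontfun x j)) \<longlonglongrightarrow> 0}"
  assume "\<not> M_weakly_compact T"
  then obtain x where "bounded (range x)" "disjoint_seq x" "\<not> (\<lambda>j. blinfun_apply T (x j)) \<longlonglongrightarrow> 0"
    by (auto simp: M_weakly_compact_def)
  then have "\<exists>z :: nat \<Rightarrow>\<^sub>C 'e. 0 \<le> z \<and> disjoint_seq (apply_bcontfun z) \<and>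
      \<not> (\<lambda>j. blinfun_apply T (apply_bcontfun z j)) \<longlonglongrightarrow> 0"
    by (intro exists_nonneg_disjoint_not_null)
      (auto simp: blinfun.diff_right dest: tendsto_diff)
  then have "?B \<inter> {x. 0 \<le> x} \<noteq> {}" by blast
  moreover have "\<exists>S. closed S \<and> infinite_dimensional S \<and> sublattice S \<and> S \<subseteq> ?B \<union> {0} \<and>
      (\<exists>y\<in>S. linf.subsequence_of y x)" if "x \<in> ?B" "0 \<le> x" for x
    using latticeable_of_homogeneous[of "\<lambda>u. norm (blinfun_apply T u)" "norm T" x] that
    by (simp add: blinfun.scaleR_right norm_blinfun tendsto_norm_zero_iff)
  ultimately show "linf.almost_positive_pointwise_latticeable ?B"
    unfolding linf.almost_positive_pointwise_latticeable_def by (intro conjI ballI impI)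
next
  let ?B = "{x :: nat \<Rightarrow>\<^sub>C 'e. disjoint_seq (apply_bcontfun x) \<and>
          \<not> weakly_null (\<lambda>j. blinfun_apply T (apply_bcontfun x j))}"
  assume "\<not> weak_M_weakly_compact T"
  then obtain x where "bounded (range x)" "disjoint_seq x" "\<not> weakly_null (\<lambda>j. blinfun_apply T (x j))"
    by (auto simp: weak_M_weakly_compact_def)
  then have "\<exists>z :: nat \<Rightarrow>\<^sub>C 'e. 0 \<le> z \<and> disjoint_seq (apply_bcontfun z) \<and>
      \<not> weakly_null (\<lambda>j. blinfun_apply T (apply_bcontfun z j))"
    by (intro exists_nonneg_disjoint_not_null)
      (auto simp: weakly_null_def blinfun.diff_right intro: tendsto_diff[of _ 0 _ _ 0, simplified])
  then have "?B \<inter> {x. 0 \<le> x} \<noteq> {}" by blast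
  moreover have "\<exists>S. closed S \<and> infinite_dimensional S \<and> sublattice S \<and> S \<subseteq> ?B \<union> {0} \<and>
      (\<exists>y\<in>S. linf.subsequence_of y x)" if "x \<in> ?B" "0 \<le> x" for x
  proof -
    from that obtain \<phi> :: "'f \<Rightarrow>\<^sub>L real"
      where \<phi>: "\<not> (\<lambda>j. blinfun_apply \<phi> (blinfun_apply T (apply_bcontfun x j))) \<longlonglongrightarrow> 0"
      by (auto simp: weakly_null_def)
    let ?G = "\<lambda>u. \<bar>blinfun_apply \<phi> (blinfun_apply T u)\<bar>"
    have "?G u \<le> norm (\<phi> o\<^sub>L T) * norm u" for u
      using norm_blinfun[of "\<phi> o\<^sub>L T" u] by simp
    then have "\<exists>S. closed S \<and> infinite_dimensional S \<and> sublattice S \<and>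
        S \<subseteq> {z. disjoint_seq (apply_bcontfun z) \<and> \<not> (\<lambda>j. ?G (apply_bcontfun z j)) \<longlonglongrightarrow> 0} \<union> {0} \<and>
        (\<exists>y\<in>S. linf.subsequence_of y x)"
      using that \<phi>
      by (intro latticeable_of_homogeneous[where K = "norm (\<phi> o\<^sub>L T)"])
        (auto simp: blinfun.scaleR_right abs_mult tendsto_rabs_zero_iff)
    moreover have "{z. disjoint_seq (apply_bcontfun z) \<and> \<not> (\<lambda>j. ?G (apply_bcontfun z j)) \<longlonglongrightarrow> 0} \<subseteq> ?B"
      by (auto simp: weakly_null_def tendsto_rabs_zero_iff)
    ultimately show ?thesis by (meson Un_mono order_refl order_trans)
  qed
  ultimately show "linf.almost_positive_pointwise_latticeable ?B"
    unfolding linf.almost_positive_pointwise_latticeable_def by (intro conjI ballI impI)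
qed

end
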